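(* Let $Q$ be an IPC formula and let $\theta = (Z_N, \dots, Z_0)$ be a finite sequence of IPC formulas, each $Z_n$ of the form $QW_n$ or $QQW_n$ for some IPC formula $W_n$, which is closed, i.e. there is an IPC formula $W$ such that both $QW$ and $QQW$ are terms of $\theta$. Then $\mathcal{D}(\theta)$ is a theorem of IPC.
   Context: The Implicational Propositional Calculus (IPC) has formulas built from propositional variables using only $\supset$, the single inference rule modus ponens, and the axiom schemes $X \supset (Y \supset X)$, $[X \supset (Y \supset Z)] \supset [(X \supset Y) \supset (X \supset Z)]$ and $[(X \supset Y) \supset X] \supset X$. For an IPC formula $Z$ write $QZ := Z \supset Q$ (so $QQZ = (Z\supset Q)\supset Q$). For a sequence $\theta = (Z_N, \dots, Z_0)$ of IPC formulas, $\mathcal{D}(\theta) := Z_N \supset (Z_{N-1} \supset ( \cdots (Z_0 \supset Q) \cdots ))$. *)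

theory Defs
  imports Main
begin

datatype 'a form =
    Var 'a
  | Imp "'a form" "'a form"  (infixr "\<^bold>\<supset>" 55)

inductive ipc_theorem :: "'a form \<Rightarrow> bool" where
  ax_K: "ipc_theorem (X \<^bold>\<supset> (Y \<^bold>\<supset> X))"
| ax_S: "ipc_theorem ((X \<^bold>\<supset> (Y \<^bold>\<supset> Z)) \<^bold>\<supset> ((X \<^bold>\<supset> Y) \<^bold>\<supset> (X \<^bold>\<supset> Z)))"
| ax_Peirce: "ipc_theorem (((X \<^bold>\<supset> Y) \<^bold>\<supset> X) \<^bold>\<supset> X)"
| modus_ponens: "ipc_theorem X \<Longrightarrow> ipc_theorem (X \<^bold>\<supset> Y) \<Longrightarrow> ipc_theorem Y"

definition rel_neg :: "'a form \<Rightarrow> 'a form \<Rightarrow> 'a form" where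
  "rel_neg Q Z = Z \<^bold>\<supset> Q"

(* A sequence (Z_N, ..., Z_0) is the list [Z_N, ..., Z_0], outermost antecedent first. *)
definition seq_form :: "'a form \<Rightarrow> 'a form list \<Rightarrow> 'a form" where
  "seq_form Q \<theta> = foldr (\<^bold>\<supset>) \<theta> Q"

definition seq_closed :: "'a form \<Rightarrow> 'a form list \<Rightarrow> bool" where
  "seq_closed Q \<theta> \<longleftrightarrow>
     (\<exists>W. rel_neg Q W \<in> set \<theta> \<and> rel_neg Q (rel_neg Q W) \<in> set \<theta>)"

end

theory Submission
  imports Defs
begin

text \<open>Read \<open>foldr\<close> over \<theta> as derivability from the hypotheses in \<theta>.
  Closedness supplies hypotheses QW and QQW, and QQW is the implication from QW to Q, so one modus
  ponens under these hypotheses gives Q. Two facts carry this: each hypothesis is derivable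
  (\<open>ipc_foldr_member\<close>), and derivability is closed under modus ponens
  (\<open>ipc_foldr_modus_ponens\<close>).\<close>

lemma ipc_weaken: "ipc_theorem Y \<Longrightarrow> ipc_theorem (X \<^bold>\<supset> Y)"
  by (rule modus_ponens[OF _ ax_K])

lemma ipc_distrib:
  "ipc_theorem (X \<^bold>\<supset> (Y \<^bold>\<supset> Z)) \<Longrightarrow> ipc_theorem ((X \<^bold>\<supset> Y) \<^bold>\<supset> (X \<^bold>\<supset> Z))"
  by (rule modus_ponens[OF _ ax_S])

lemma ipc_trans:
  assumes "ipc_theorem (X \<^bold>\<supset> Y)" and "ipc_theorem (Y \<^bold>\<supset> Z)"
  shows "ipc_theorem (X \<^bold>\<supset> Z)"
  by (rule modus_ponens[OF assms(1) ipc_distrib[OF ipc_weaken[OF assms(2)]]])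

lemma ipc_refl: "ipc_theorem (X \<^bold>\<supset> X)"
  by (rule modus_ponens[OF ax_K ipc_distrib[OF ax_K]])

lemma ipc_foldr_weaken: "ipc_theorem (X \<^bold>\<supset> foldr (\<^bold>\<supset>) \<theta> X)"
proof (induction \<theta>)
  case Nil
  show ?case by (simp add: ipc_refl)
next
  case (Cons Z \<theta>)
  show ?case using ipc_trans[OF Cons.IH ax_K] by simp
qed

text \<open>At an occurrence of Z, \<open>ipc_foldr_weaken\<close> inserts the antecedents inside
  it, and \<open>ipc_weaken\<close> adds those outside it.\<close>

lemma ipc_foldr_member: "Z \<in> set \<theta> \<Longrightarrow> ipc_theorem (foldr (\<^bold>\<supset>) \<theta> Z)"
  by (induction \<theta>) (auto intro: ipc_foldr_weaken ipc_weaken)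

text \<open>This is \<open>ax_S\<close> iterated along \<theta>: the induction hypothesis is carried
  under the new antecedent, which a further \<open>ax_S\<close> then distributes.\<close>

lemma ipc_foldr_distrib:
  "ipc_theorem (foldr (\<^bold>\<supset>) \<theta> (X \<^bold>\<supset> Y) \<^bold>\<supset> (foldr (\<^bold>\<supset>) \<theta> X \<^bold>\<supset> foldr (\<^bold>\<supset>) \<theta> Y))"
proof (induction \<theta>)
  case Nil
  show ?case by (simp add: ipc_refl)
next
  case (Cons Z \<theta>)
  show ?case using ipc_trans[OF ipc_distrib[OF ipc_weaken[OF Cons.IH]] ax_S] by simp
qed

lemma ipc_foldr_modus_ponens:
  assumes "ipc_theorem (foldr (\<^bold>\<supset>) \<theta> X)" and "ipc_theorem (foldr (\<^bold>\<supset>) \<theta> (X \<^bold>\<supset> Y))"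
  shows "ipc_theorem (foldr (\<^bold>\<supset>) \<theta> Y)"
  by (rule modus_ponens[OF assms(1) modus_ponens[OF assms(2) ipc_foldr_distrib]])

theorem theorem7:
  fixes Q :: "'a form" and \<theta> :: "'a form list"
  assumes "\<forall>Z \<in> set \<theta>. \<exists>W. Z = rel_neg Q W \<or> Z = rel_neg Q (rel_neg Q W)"
    and "seq_closed Q \<theta>"
  shows "ipc_theorem (seq_form Q \<theta>)"
proof -
  \<comment> \<open>QQW is unfolded once to expose QW as its antecedent, the shape modus ponens
    needs.\<close>
  obtain W where "rel_neg Q W \<in> set \<theta>" and "rel_neg Q W \<^bold>\<supset> Q \<in> set \<theta>"
    using assms(2) unfolding seq_closed_def rel_neg_def by blast
  then show ?thesis
    unfolding seq_form_def by (intro ipc_foldr_modus_ponens[OF ipc_foldr_member ipc_foldr_member])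
qed

end
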